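(* Let $m\ge 1$ and let $F(x_1,\dots,x_m)$ be a good linear combination of Schur polynomials $s_\mu(x_1,\dots,x_m)$ associated to partitions $\mu$ with at most $m$ parts. Then $F$ has saturated Newton polytope (SNP), and $Newton(F)$ has the integer decomposition property (IDP).
   Context: **Polytopes.** A lattice polytope in $\mathbb{R}^m$ is the convex hull of finitely many points whose vertices lie in $\mathbb{Z}^m$. For a positive integer $t$, $t\mathcal{P}=\{tv \mid v\in\mathcal{P}\}$. A lattice polytope $\mathcal{P}$ has the integer decomposition property (IDP) if for every positive integer $t$ and every $p\in t\mathcal{P}\cap\mathbb{Z}^m$ there are $t$ points $v_1,\dots,v_t\in\mathcal{P}\cap\mathbb{Z}^m$ (not necessarily distinct) with $p=v_1+\dots+v_t$. **Newton polytopes.** For $f=\sum_{\alpha\in\mathbb{Z}_{\ge 0}^m}c_\alpha x^\alpha\in\mathbb{C}[x_1,\dots,x_m]$, let $Supp(f)=\{\alpha\in\mathbb{Z}_{\ge0}^m \mid c_\alpha\neq 0\}$ and let $Newton(f)=Conv(Supp(f))$ be its convex hull in $\mathbb{R}^m$. The polynomial $f$ has saturated Newton polytope (SNP) if $Newton(f)\cap\mathbb{Z}^m=Supp(f)$. **Partitions and Schur polynomials.** A partition with at most $m$ parts is a weakly decreasing sequence $\lambda=(\lambda_1,\dots,\lambda_m)$ of nonnegative integers; its size is $|\lambda|=\sum_i\lambda_i$. It is identified with its Young diagram, which has $\lambda_i$ boxes, left-justified, in the $i$-th row from the top. The Schur polynomial $s_\lambda(x_1,\dots,x_m)$ is the sum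 of $x^T=x_1^{\alpha_1}\cdots x_m^{\alpha_m}$ over all semistandard Young tableaux $T$ of shape $\lambda$ with entries in $\{1,\dots,m\}$ (rows weakly increasing, columns strictly increasing from top to bottom), where $\alpha_i$ is the number of entries $i$ in $T$. **Orders.** For partitions with at most $m$ parts, $\beta\ge\alpha$ means $\beta_i\ge\alpha_i$ for all $i$ (and $\beta>\alpha$ means in addition $\beta\ne\alpha$). If $|\alpha|=|\beta|$, then $\beta\trianglerighteq\alpha$ ($\beta$ dominates $\alpha$) means $\sum_{i=1}^j\beta_i\ge\sum_{i=1}^j\alpha_i$ for all $j\ge1$. **Good linear combinations.** Let $F=\sum_\mu C_\mu s_\mu(x_1,\dots,x_m)$ be a linear combination of Schur polynomials of partitions with at most $m$ parts; $s_\mu$ appears in $F$ if $C_\mu\ne0$. For each size $d$ for which some $s_\mu$ with $|\mu|=d$ appears in $F$, the corresponding bracket of $F$ is the sum $\sum_{|\mu|=d}C_\mu s_\mu$, and its Schur elements are the $s_\mu$ with $|\mu|=d$ and $C_\mu\neq0$. $F$ is called good if: (a) the support of each bracket equals the union of the supports of its Schur elements; (b) let $l+1$ be the number of brackets of $F$. Among the partitions indexing the Schur elements of each bracket there is a unique $\trianglerighteq$-maximum partition (one which dominates all the others of that bracket), and these maximum partitions form a chain $\alpha=\lambda^0<\lambda^1<\dots<\lambda^l=\beta$, where $\alpha\le\beta$ are fixed partitions and, for each $i>0$, $\lambda^i$ is obtained from $\lambda^{i-1}$ by adding one box in the northmost (topmost) row of $\lambda^{i-1}$ such that the addition gives a Young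 diagram with $\alpha<\lambda^i\le\beta$. *)

theory Defs
  imports "HOL-Analysis.Analysis" "HOL-Library.Poly_Mapping"
begin

section \<open>Lattice polytopes\<close>

definition lattice_points :: "(real^'m) set" where
  "lattice_points = {v. \<forall>i. v $ i \<in> \<int>}"

definition lattice_polytope :: "(real^'m) set \<Rightarrow> bool" where
  "lattice_polytope P \<longleftrightarrow> polytope P \<and> (\<forall>v. v extreme_point_of P \<longrightarrow> v \<in> lattice_points)"

definition IDP :: "(real^'m) set \<Rightarrow> bool" where
  "IDP P \<longleftrightarrow> lattice_polytope P \<and>
    (\<forall>t::nat. 0 < t \<longrightarrow> (\<forall>p \<in> (\<lambda>v. real t *\<^sub>R v) ` P \<inter> lattice_points.
       \<exists>v :: nat \<Rightarrow> real^'m. (\<forall>i<t. v i \<in> P \<inter> lattice_points) \<and> p = (\<Sum>i<t. v i)))"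


section \<open>Polynomials and Newton polytopes\<close>

text \<open>
  A polynomial over the complex numbers in variables \<open>x\<^sub>i\<close> indexed by the finite type \<open>'m\<close> is a
  finitely supported family of coefficients indexed by exponent vectors. Sums and products are
  those of \<^theory>\<open>HOL-Library.Poly_Mapping\<close> (products are convolutions), and
  \<^const>\<open>Poly_Mapping.keys\<close> gives the support. Where the order of the variables matters, \<open>'m\<close> is also
  linearly ordered; it then stands for \<open>{1 < \<dots> < m}\<close> with \<open>m = CARD('m) \<ge> 1\<close>.
\<close>

type_synonym 'm mpoly = "(nat^'m) \<Rightarrow>\<^sub>0 complex"

definition real_vec :: "nat^'m \<Rightarrow> real^'m" where
  "real_vec \<alpha> = (\<chi> i. real (\<alpha> $ i))"

definition Newton :: "'m::finite mpoly \<Rightarrow> (real^'m) set" where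
  "Newton f = convex hull (real_vec ` Poly_Mapping.keys f)"

definition SNP :: "'m::finite mpoly \<Rightarrow> bool" where
  "SNP f \<longleftrightarrow> Newton f \<inter> lattice_points = real_vec ` Poly_Mapping.keys f"


section \<open>Partitions and Schur polynomials\<close>

definition is_partition :: "nat^('m::{finite,linorder}) \<Rightarrow> bool" where
  "is_partition \<mu> \<longleftrightarrow> (\<forall>i j. i \<le> j \<longrightarrow> \<mu> $ j \<le> \<mu> $ i)"

definition psize :: "nat^'m \<Rightarrow> nat" where
  "psize \<mu> = (\<Sum>i\<in>UNIV. \<mu> $ i)"

text \<open>Boxes are pairs of a row in \<open>'m\<close> and a column; columns are counted from 0.\<close>

definition diagram :: "nat^'m \<Rightarrow> ('m \<times> nat) set" where
  "diagram \<mu> = {(i, j). j < \<mu> $ i}"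

text \<open>
  Tableaux are \<^const>\<open>undefined\<close> outside the diagram, so that each filling is represented by exactly one
  function.
\<close>

definition ssyt :: "nat^('m::{finite,linorder}) \<Rightarrow> ('m \<times> nat \<Rightarrow> 'm) set" where
  "ssyt \<mu> = {T \<in> diagram \<mu> \<rightarrow>\<^sub>E UNIV.
     (\<forall>i j j'. (i, j) \<in> diagram \<mu> \<and> (i, j') \<in> diagram \<mu> \<and> j < j' \<longrightarrow> T (i, j) \<le> T (i, j')) \<and>
     (\<forall>i i' j. (i, j) \<in> diagram \<mu> \<and> (i', j) \<in> diagram \<mu> \<and> i < i' \<longrightarrow> T (i, j) < T (i', j))}"

lemma finite_diagram: "finite (diagram \<mu>)"
proof -
  have "diagram \<mu> = (SIGMA i:UNIV. {..<\<mu> $ i})"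
    by (auto simp: diagram_def)
  then show ?thesis
    by simp
qed

lemma finite_ssyt: "finite (ssyt \<mu>)"
  by (rule finite_subset[OF _ finite_PiE[OF finite_diagram[of \<mu>], of "\<lambda>_. UNIV"]])
    (auto simp: ssyt_def)

definition content :: "nat^'m \<Rightarrow> ('m \<times> nat \<Rightarrow> 'm) \<Rightarrow> nat^'m" where
  "content \<mu> T = (\<chi> k. card {b \<in> diagram \<mu>. T b = k})"

definition schur :: "nat^('m::{finite,linorder}) \<Rightarrow> 'm mpoly" where
  "schur \<mu> = (\<Sum>T\<in>ssyt \<mu>. Poly_Mapping.single (content \<mu> T) 1)"

text \<open>
  The order \<open>\<le>\<close> on \<open>nat^'m\<close> is the library's componentwise order, that is, containment of diagrams.
\<close>

definition dominates :: "nat^('m::{finite,linorder}) \<Rightarrow> nat^('m::{finite,linorder}) \<Rightarrow> bool" where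
  "dominates \<beta> \<alpha> \<longleftrightarrow> psize \<alpha> = psize \<beta> \<and> (\<forall>j. (\<Sum>i\<in>{..j}. \<alpha> $ i) \<le> (\<Sum>i\<in>{..j}. \<beta> $ i))"


section \<open>Good linear combinations of Schur polynomials\<close>

text \<open>
  A linear combination is given by its coefficient family \<open>C\<close>, which is nonzero at only finitely many
  vectors, all of them partitions.
\<close>

definition schur_comb :: "(nat^('m::{finite,linorder}) \<Rightarrow> complex) \<Rightarrow> 'm mpoly" where
  "schur_comb C = (\<Sum>\<mu> | C \<mu> \<noteq> 0. Poly_Mapping.single 0 (C \<mu>) * schur \<mu>)"

definition degrees :: "(nat^'m \<Rightarrow> complex) \<Rightarrow> nat set" where
  "degrees C = psize ` {\<mu>. C \<mu> \<noteq> 0}"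

definition bracket_index :: "(nat^'m \<Rightarrow> complex) \<Rightarrow> nat \<Rightarrow> (nat^'m) set" where
  "bracket_index C d = {\<mu>. psize \<mu> = d \<and> C \<mu> \<noteq> 0}"

definition bracket :: "(nat^('m::{finite,linorder}) \<Rightarrow> complex) \<Rightarrow> nat \<Rightarrow> 'm mpoly" where
  "bracket C d = (\<Sum>\<mu>\<in>bracket_index C d. Poly_Mapping.single 0 (C \<mu>) * schur \<mu>)"

definition bracket_max :: "(nat^('m::{finite,linorder}) \<Rightarrow> complex) \<Rightarrow> nat \<Rightarrow> nat^('m::{finite,linorder}) \<Rightarrow> bool" where
  "bracket_max C d \<mu> \<longleftrightarrow> \<mu> \<in> bracket_index C d \<and> (\<forall>\<nu> \<in> bracket_index C d. dominates \<mu> \<nu>)"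

text \<open>
  \<open>\<mu> + axis r 1\<close> is \<open>\<mu>\<close> with a box added in row \<open>r\<close> (which may be empty in \<open>\<mu>\<close>).
  The least admissible row is the topmost one.
\<close>

definition admissible_row ::
  "nat^('m::{finite,linorder}) \<Rightarrow> nat^('m::{finite,linorder}) \<Rightarrow> nat^('m::{finite,linorder}) \<Rightarrow> 'm \<Rightarrow> bool" where
  "admissible_row \<alpha> \<beta> \<mu> r \<longleftrightarrow>
     is_partition (\<mu> + axis r 1) \<and> \<alpha> < \<mu> + axis r 1 \<and> \<mu> + axis r 1 \<le> \<beta>"

definition adds_northmost_box ::
  "nat^('m::{finite,linorder}) \<Rightarrow> nat^('m::{finite,linorder}) \<Rightarrow> nat^('m::{finite,linorder}) \<Rightarrow> nat^('m::{finite,linorder}) \<Rightarrow> bool" where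
  "adds_northmost_box \<alpha> \<beta> \<mu> \<nu> \<longleftrightarrow>
     (\<exists>r. admissible_row \<alpha> \<beta> \<mu> r \<and> (\<forall>r'. admissible_row \<alpha> \<beta> \<mu> r' \<longrightarrow> r \<le> r') \<and>
          \<nu> = \<mu> + axis r 1)"

text \<open>
  The number of brackets is \<open>l + 1\<close> with \<open>l\<close> a natural number; in particular there is at least one
  bracket.
\<close>

definition good :: "(nat^('m::{finite,linorder}) \<Rightarrow> complex) \<Rightarrow> bool" where
  "good C \<longleftrightarrow>
     (\<forall>d \<in> degrees C. Poly_Mapping.keys (bracket C d) =
        (\<Union>\<mu> \<in> bracket_index C d. Poly_Mapping.keys (schur \<mu>))) \<and>
     (\<forall>d \<in> degrees C. \<exists>!\<mu>. bracket_max C d \<mu>) \<and>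
     (\<exists>\<alpha> \<beta> l \<Lambda>.
        is_partition \<alpha> \<and> is_partition \<beta> \<and> \<alpha> \<le> \<beta> \<and> card (degrees C) = l + 1 \<and>
        {\<mu>. \<exists>d \<in> degrees C. bracket_max C d \<mu>} = \<Lambda> ` {0..l} \<and>
        \<Lambda> 0 = \<alpha> \<and> \<Lambda> l = \<beta> \<and>
        (\<forall>i \<in> {1..l}. \<Lambda> (i - 1) < \<Lambda> i \<and> adds_northmost_box \<alpha> \<beta> (\<Lambda> (i - 1)) (\<Lambda> i)))"

end

theory Submission
  imports Defs
begin

text \<open>
  Both claims come down to one statement about lattice points. Let \<open>B\<^sub>k\<close> be the sum of the first \<open>k\<close>
  parts of the last partition \<open>\<beta>\<close> of the chain and \<open>A\<^sub>k\<close> the sum of the last \<open>k\<close> parts of the first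
  one, \<open>\<alpha>\<close>. The points \<open>x\<close> with \<open>A\<^bsub>|S|\<^esub> \<le> x(S) \<le> B\<^bsub>|S|\<^esub>\<close> for all sets \<open>S\<close> of coordinates form a convex
  set \<open>Q\<close>, where \<open>x(S)\<close> is the sum of the coordinates of \<open>x\<close> in \<open>S\<close>; it contains the support of \<open>F\<close> and
  hence \<open>Newton(F)\<close>. It is enough that each lattice point of \<open>tQ\<close> is a sum of \<open>t\<close> exponents of \<open>F\<close>:
  the case \<open>t = 1\<close> is SNP, the general case is IDP.

  The exponents of a Schur polynomial \<open>s\<^sub>\<mu>\<close> are the vectors \<open>\<gamma>\<close> of size \<open>|\<mu>|\<close> such that \<open>\<gamma>(S)\<close> is at most
  the sum of the first \<open>|S|\<close> parts of \<open>\<mu>\<close>, for all \<open>S\<close> (\<open>keys_schur\<close>). This description is monotone in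
  the dominance order, so a bracket has the same exponents as its maximal Schur element. It also
  reduces the decomposition to tableaux: if \<open>\<gamma>\<close> satisfies these inequalities for \<open>\<lambda> + \<mu>\<close>, take
  a tableau of shape \<open>\<lambda> + \<mu>\<close> and content \<open>\<gamma>\<close>. Its columns can be distributed over two diagrams of shapes
  \<open>\<lambda>\<close> and \<open>\<mu>\<close>, and this writes \<open>\<gamma>\<close> as a sum of two exponents (\<open>dominated_add_split\<close>).

  The condition on the chain says that the rows of \<open>\<alpha>\<close> are filled up to those of \<open>\<beta>\<close> one after the
  other, from the top. For each \<open>k\<close>, therefore, a member of the chain agrees with \<open>\<beta>\<close> in its first \<open>k\<close>
  rows or with \<open>\<alpha>\<close> in the remaining ones (\<open>greedy_cut\<close>). Given a lattice point of \<open>tQ\<close> of size \<open>d\<close>, choose \<open>t\<close>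
  members of the chain whose sizes add up to \<open>d\<close> and differ by at most one. Then at each \<open>k\<close> the same
  alternative holds for all \<open>t\<close> of them, and the inequalities of \<open>tQ\<close> imply that the point satisfies
  the inequalities for the sum of these \<open>t\<close> partitions (\<open>chain_decomposition\<close>).
\<close>

section \<open>Tableaux of given shape and content\<close>

text \<open>
  For a partition \<open>\<kappa>\<close>, with rows numbered from 0, and the letters \<open>X\<close>, these are the lattice points of
  the permutohedron of \<open>\<kappa>\<close>. Rows are natural numbers while letters come from an arbitrary set, because
  the rows get shifted in the proofs and the letters get removed.
\<close>

definition dominated :: "(nat \<Rightarrow> nat) \<Rightarrow> 'a set \<Rightarrow> ('a \<Rightarrow> nat) \<Rightarrow> bool" where
  "dominated \<kappa> X \<gamma> \<longleftrightarrow> (\<forall>S\<subseteq>X. sum \<gamma> S \<le> sum \<kappa> {..<card S}) \<and> sum \<gamma> X = sum \<kappa> {..<card X}"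

definition boxes :: "(nat \<Rightarrow> nat) \<Rightarrow> (nat \<times> nat) set" where
  "boxes \<kappa> = {(i, j). j < \<kappa> i}"

definition shape :: "nat \<Rightarrow> (nat \<Rightarrow> nat) \<Rightarrow> bool" where
  "shape n \<kappa> \<longleftrightarrow> antimono \<kappa> \<and> (\<forall>i\<ge>n. \<kappa> i = 0)"

definition tableau :: "(nat \<Rightarrow> nat) \<Rightarrow> 'a::linorder set \<Rightarrow> (nat \<Rightarrow> nat \<Rightarrow> 'a) \<Rightarrow> bool" where
  "tableau \<kappa> X T \<longleftrightarrow> (\<forall>i j. j < \<kappa> i \<longrightarrow> T i j \<in> X) \<and>
     (\<forall>i j j'. j < j' \<and> j' < \<kappa> i \<longrightarrow> T i j \<le> T i j') \<and>
     (\<forall>i i' j. i < i' \<and> j < \<kappa> i' \<longrightarrow> T i j < T i' j)"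

lemma shape_antimonoD: "shape n \<kappa> \<Longrightarrow> i \<le> j \<Longrightarrow> \<kappa> j \<le> \<kappa> i"
  by (auto simp: shape_def dest: antimonoD)

lemma boxes_Sigma: "shape n \<kappa> \<Longrightarrow> boxes \<kappa> = (SIGMA i:{..<n}. {..<\<kappa> i})"
  unfolding boxes_def shape_def by (auto simp: not_less[symmetric])

lemma finite_boxes: "shape n \<kappa> \<Longrightarrow> finite (boxes \<kappa>)"
  by (simp add: boxes_Sigma)

text \<open>
  The boxes that hold the largest letter \<open>x\<close> form a horizontal strip of \<open>\<gamma> x\<close> boxes. Removing such a
  strip from as far down as possible leaves the dominance-largest \<open>\<mu>\<close>: its first \<open>k\<close> rows together lose
  only what does not fit into the strip below, which gives the partial sums \<open>M k\<close> of the proof. The two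
  terms of the minimum in \<open>M k\<close> are the bounds that the hypothesis provides for \<open>S\<close> and for \<open>S\<close>
  with \<open>x\<close> added.
\<close>

lemma remove_strip:
  fixes \<gamma> :: "'a::linorder \<Rightarrow> nat"
  assumes X: "finite X" "x \<notin> X" and sh: "shape (Suc (card X)) \<kappa>"
    and dom: "dominated \<kappa> (insert x X) \<gamma>"
  obtains \<mu> where "shape (card X) \<mu>" "dominated \<mu> X \<gamma>"
    "\<And>i. \<kappa> (Suc i) \<le> \<mu> i" "\<And>i. \<mu> i \<le> \<kappa> i"
    "sum \<kappa> {..<Suc (card X)} = sum \<mu> {..<Suc (card X)} + \<gamma> x"
proof -
  define n where "n = card X"
  define L where "L k = sum \<kappa> {..<k}" for k
  define M where "M k = min (L k) (L (Suc k) - \<gamma> x)" for k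
  \<comment> \<open>The subtraction in \<open>M\<close> does not truncate, by \<open>Lx\<close> below.\<close>
  define \<mu> where "\<mu> k = M (Suc k) - M k" for k
  have LS: "L (Suc k) = L k + \<kappa> k" for k by (simp add: L_def)
  have bound: "sum \<gamma> S \<le> L (card S)" if "S \<subseteq> insert x X" for S
    using dom that by (auto simp: dominated_def L_def)
  have tot: "sum \<gamma> X + \<gamma> x = L (Suc n)"
    using dom X by (simp add: dominated_def L_def n_def)
  have "\<gamma> x \<le> L (Suc 0)" using bound[of "{x}"] by simp
  then have Lx: "\<gamma> x \<le> L (Suc k)" for k
    using LS by (induction k) (auto intro: le_trans)
  have anti: "\<kappa> (Suc k) \<le> \<kappa> k" for k using sh shape_antimonoD by fastforce
  have step1: "M k + \<kappa> (Suc k) \<le> M (Suc k)" for k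
    using Lx[of k] anti[of k] LS[of k] LS[of "Suc k"] by (auto simp: M_def)
  have step2: "M (Suc k) \<le> M k + \<kappa> k" for k
    using Lx[of k] anti[of k] LS[of k] LS[of "Suc k"] by (auto simp: M_def)
  have M0: "M 0 = 0" by (simp add: M_def L_def)
  have Mle: "M k \<le> M (Suc k)" for k using step1[of k] by simp
  have sum\<mu>: "sum \<mu> {..<k} = M k" for k
  proof (induction k)
    case (Suc k)
    then show ?case using Mle[of k] by (simp add: \<mu>_def)
  qed (simp add: M0)
  have z: "\<kappa> i = 0" if "i \<ge> Suc n" for i using sh that by (auto simp: shape_def n_def)
  have "sum \<gamma> X \<le> L n" using bound[of X] by (auto simp: n_def)
  then have Mn: "M n = L (Suc n) - \<gamma> x" using tot by (simp add: M_def)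
  have Lz: "L k = L (Suc n)" if "k \<ge> Suc n" for k
    using that by (induction k rule: dec_induct) (auto simp: LS z)
  have Mz: "M k = L (Suc n) - \<gamma> x" if "k \<ge> n" for k
    using that Mn Lz[of k] Lz[of "Suc k"] by (cases "k = n") (auto simp: M_def)
  have mu1: "\<kappa> (Suc i) \<le> \<mu> i" for i using step1[of i] by (simp add: \<mu>_def)
  have mu2: "\<mu> i \<le> \<kappa> i" for i using step2[of i] by (simp add: \<mu>_def)
  have "\<mu> (Suc i) \<le> \<mu> i" for i using mu1[of i] mu2[of "Suc i"] by simp
  then have "antimono \<mu>" by (simp add: antimono_iff_le_Suc)
  moreover have "\<mu> i = 0" if "i \<ge> n" for i using that Mz[of i] Mz[of "Suc i"] by (simp add: \<mu>_def)
  ultimately have s\<mu>: "shape n \<mu>" by (simp add: shape_def)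
  have d\<mu>: "dominated \<mu> X \<gamma>"
    unfolding dominated_def
  proof (intro conjI allI impI)
    fix S assume S: "S \<subseteq> X"
    then have fS: "finite S" "x \<notin> S" using X finite_subset by auto
    have "sum \<gamma> S \<le> L (card S)" using S bound[of S] by auto
    moreover have "sum \<gamma> S + \<gamma> x \<le> L (Suc (card S))"
      using S bound[of "insert x S"] fS by (auto simp: add.commute)
    ultimately show "sum \<gamma> S \<le> sum \<mu> {..<card S}" by (simp add: sum\<mu> M_def)
  next
    show "sum \<gamma> X = sum \<mu> {..<card X}" using tot Mn by (simp add: sum\<mu> n_def[symmetric])
  qed
  have "L (Suc n) = M (Suc n) + \<gamma> x" using Mz[of "Suc n"] Lx[of n] by simp
  then have "sum \<kappa> {..<Suc n} = sum \<mu> {..<Suc n} + \<gamma> x" by (simp only: sum\<mu> L_def)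
  then show thesis using that[of \<mu>] s\<mu> d\<mu> mu1 mu2 by (simp add: n_def)
qed

text \<open>
  The part of Kostka positivity that builds a tableau: remove the strips of the letters in decreasing
  order, then fill them in. The recursion works because \<open>dominated\<close> bounds \<open>\<gamma>\<close> on all sets of
  letters, so that it passes to the remaining letters in whatever order their multiplicities come.
\<close>

lemma tableau_exists:
  fixes X :: "'a::linorder set"
  assumes "finite X" "shape (card X) \<kappa>" "dominated \<kappa> X \<gamma>"
  obtains T where "tableau \<kappa> X T" "\<And>k. k \<in> X \<Longrightarrow> card {(i, j) \<in> boxes \<kappa>. T i j = k} = \<gamma> k"
  using assms
proof (induction X arbitrary: \<kappa> thesis rule: finite_linorder_max_induct)
  case empty
  then show ?case by (auto simp: shape_def tableau_def)
next
  case (insert x X)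
  have xX: "x \<notin> X" using insert.hyps by auto
  then have cX: "card (insert x X) = Suc (card X)" using insert.hyps by simp
  obtain \<mu> where \<mu>: "shape (card X) \<mu>" "dominated \<mu> X \<gamma>"
    and le: "\<And>i. \<kappa> (Suc i) \<le> \<mu> i" "\<And>i. \<mu> i \<le> \<kappa> i"
    and size: "sum \<kappa> {..<Suc (card X)} = sum \<mu> {..<Suc (card X)} + \<gamma> x"
    using remove_strip[of X x \<kappa> \<gamma>] insert.hyps insert.prems cX xX by metis
  obtain T where T: "tableau \<mu> X T"
    and wt: "\<And>k. k \<in> X \<Longrightarrow> card {(i, j) \<in> boxes \<mu>. T i j = k} = \<gamma> k"
    using insert.IH[OF _ \<mu>] by blast
  define T' where "T' i j = (if j < \<mu> i then T i j else x)" for i j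
  have TX: "T i j \<in> X" "T i j < x" if "j < \<mu> i" for i j
    using T insert.hyps that by (auto simp: tableau_def)
  have sh: "shape (Suc (card X)) \<kappa>" using insert.prems cX by simp
  \<comment> \<open>Below a box that holds \<open>x\<close> there is no box of the diagram.\<close>
  have strip: "j < \<mu> i" if "i < i'" "j < \<kappa> i'" for i i' j
    using that le(1)[of i] shape_antimonoD[OF sh, of "Suc i" i'] by simp
  have "tableau \<kappa> (insert x X) T'"
    unfolding tableau_def
  proof (intro conjI allI impI; (elim conjE)?)
    fix i j j' assume "j < j'" "j' < \<kappa> i"
    then show "T' i j \<le> T' i j'"
      using T TX[of j i] by (auto simp: T'_def tableau_def)
  next
    fix i i' j assume ij: "i < i'" "j < \<kappa> i'"
    show "T' i j < T' i' j"
      using strip[OF ij] T TX[of j i] ij by (auto simp: T'_def tableau_def)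
  qed (use TX in \<open>auto simp: T'_def\<close>)
  moreover have "card {(i, j) \<in> boxes \<kappa>. T' i j = k} = \<gamma> k" if "k \<in> insert x X" for k
  proof (cases "k = x")
    case False
    then have "{(i, j) \<in> boxes \<kappa>. T' i j = k} = {(i, j) \<in> boxes \<mu>. T i j = k}"
      using le(2) by (auto simp: boxes_def T'_def intro: less_le_trans)
    then show ?thesis using wt that False by simp
  next
    case True
    have "{(i, j) \<in> boxes \<kappa>. T' i j = x} = (SIGMA i:{..<Suc (card X)}. {\<mu> i..<\<kappa> i})"
      unfolding boxes_Sigma[OF sh] using TX by (fastforce simp: T'_def split: if_splits)
    then have "card {(i, j) \<in> boxes \<kappa>. T' i j = x} = (\<Sum>i<Suc (card X). \<kappa> i - \<mu> i)"
      by simp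
    also have "\<dots> = sum \<kappa> {..<Suc (card X)} - sum \<mu> {..<Suc (card X)}"
      using le(2) by (intro sum_subtractf_nat) auto
    finally show ?thesis using size True by simp
  qed
  ultimately show ?case using insert.prems(1) by blast
qed

text \<open>
  A column has distinct entries, so it contains at most as many letters of \<open>S\<close> as it has boxes in the
  first \<open>card S\<close> rows. Restricting the count to a set \<open>J\<close> of columns makes the bound available for
  subtableaux as well.
\<close>

lemma entries_in_columns_le:
  assumes sh: "shape n \<kappa>" and T: "tableau \<kappa> X T" and S: "finite S"
  shows "card {(i, j) \<in> boxes \<kappa>. j \<in> J \<and> T i j \<in> S} \<le> (\<Sum>i<card S. card (J \<inter> {..<\<kappa> i}))"
proof -
  define c where "c = card S"
  have fin: "finite {i. j < \<kappa> i}" for j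
  proof (rule finite_subset)
    show "{i. j < \<kappa> i} \<subseteq> {..<n}" using sh by (auto simp: shape_def not_le[symmetric])
  qed simp
  have anti: "i \<le> i' \<Longrightarrow> \<kappa> i' \<le> \<kappa> i" for i i' using shape_antimonoD[OF sh] .
  \<comment> \<open>In a column of more than \<open>c\<close> boxes the bound is \<open>card S\<close>, by distinctness; otherwise it is the height.\<close>
  have col: "card {i. j < \<kappa> i \<and> T i j \<in> S} \<le> card {i. i < c \<and> j < \<kappa> i}" for j
  proof (cases "j < \<kappa> c")
    case True
    have "inj_on (\<lambda>i. T i j) {i. j < \<kappa> i \<and> T i j \<in> S}"
    proof (rule linorder_inj_onI)
      fix i i' assume "i < i'" "i \<in> {i. j < \<kappa> i \<and> T i j \<in> S}" "i' \<in> {i. j < \<kappa> i \<and> T i j \<in> S}"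
      then have "T i j < T i' j" using T by (auto simp: tableau_def)
      then show "T i j \<noteq> T i' j" by simp
    qed auto
    then have "card {i. j < \<kappa> i \<and> T i j \<in> S} \<le> card S"
      using S by (intro card_inj_on_le) auto
    moreover have "{i. i < c \<and> j < \<kappa> i} = {..<c}"
      using True anti by (auto intro: less_le_trans)
    ultimately show ?thesis by (simp add: c_def)
  next
    case False
    have "{i. j < \<kappa> i \<and> T i j \<in> S} \<subseteq> {i. i < c \<and> j < \<kappa> i}"
      using False anti by (auto simp: not_less) (metis anti le_trans not_le)
    then show ?thesis by (intro card_mono) auto
  qed
  define K where "K = J \<inter> {..<\<kappa> 0}"
  have K: "j \<in> K" if "j \<in> J" "j < \<kappa> i" for i j
    using that anti[of 0 i] by (auto simp: K_def)
  have fK: "finite K" by (simp add: K_def)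
  have "card {(i, j) \<in> boxes \<kappa>. j \<in> J \<and> T i j \<in> S}
      = card (SIGMA j:K. {i. j < \<kappa> i \<and> T i j \<in> S})"
    using K by (intro bij_betw_same_card[of prod.swap] bij_betw_byWitness[of _ prod.swap])
      (auto simp: boxes_def K_def)
  also have "\<dots> = (\<Sum>j\<in>K. card {i. j < \<kappa> i \<and> T i j \<in> S})"
    using fK fin by (intro card_SigmaI) (auto intro: finite_subset[OF _ fin])
  also have "\<dots> \<le> (\<Sum>j\<in>K. card {i. i < c \<and> j < \<kappa> i})"
    by (intro sum_mono col)
  also have "\<dots> = card (SIGMA j:K. {i. i < c \<and> j < \<kappa> i})"
    using fK by (intro card_SigmaI[symmetric]) auto
  also have "\<dots> = card (SIGMA i:{..<c}. J \<inter> {..<\<kappa> i})"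
    using K by (intro bij_betw_same_card[of prod.swap] bij_betw_byWitness[of _ prod.swap])
      (auto simp: K_def)
  also have "\<dots> = (\<Sum>i<c. card (J \<inter> {..<\<kappa> i}))"
    by simp
  finally show ?thesis by (simp add: c_def)
qed

text \<open>
  Between the lengths of two successive rows of the diagram of \<open>\<kappa> + \<mu>\<close> there are
  \<open>(\<kappa> i - \<kappa> (i + 1)) + (\<mu> i - \<mu> (i + 1))\<close> columns of the same height, and \<open>J\<close> takes
  \<open>\<kappa> i - \<kappa> (i + 1)\<close> of them. The columns in \<open>J\<close> then make up the diagram of \<open>\<kappa>\<close>, the others that of \<open>\<mu>\<close>.
\<close>

lemma split_columns:
  assumes "shape n \<kappa>" "shape n \<mu>"
  obtains J where "\<And>i. card (J \<inter> {..<\<kappa> i + \<mu> i}) = \<kappa> i"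
proof -
  have "\<exists>J. \<forall>i. card (J \<inter> {..<\<kappa> i + \<mu> i}) = \<kappa> i"
    using assms
  proof (induction n arbitrary: \<kappa> \<mu>)
    case 0
    then show ?case by (auto simp: shape_def)
  next
    case (Suc n)
    have "shape n (\<lambda>i. \<kappa> (Suc i))" "shape n (\<lambda>i. \<mu> (Suc i))"
      using Suc.prems by (auto simp: shape_def antimono_def)
    from Suc.IH[OF this] obtain J where
      J: "\<And>i. card (J \<inter> {..<\<kappa> (Suc i) + \<mu> (Suc i)}) = \<kappa> (Suc i)" by blast
    define a where "a = \<kappa> 1 + \<mu> 1"
    define J' where "J' = (J \<inter> {..<a}) \<union> {a..<a + (\<kappa> 0 - \<kappa> 1)}"
    have anti: "i \<le> i' \<Longrightarrow> \<kappa> i' \<le> \<kappa> i" "i \<le> i' \<Longrightarrow> \<mu> i' \<le> \<mu> i" for i i'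
      using Suc.prems shape_antimonoD by blast+
    have "card (J' \<inter> {..<\<kappa> i + \<mu> i}) = \<kappa> i" for i
    proof (cases i)
      case 0
      have "J' \<inter> {..<\<kappa> 0 + \<mu> 0} = J'" using anti[of 0 1] by (auto simp: J'_def a_def)
      moreover have "card J' = card (J \<inter> {..<a}) + (\<kappa> 0 - \<kappa> 1)"
        unfolding J'_def by (subst card_Un_disjoint) auto
      ultimately show ?thesis using 0 J[of 0] anti(1)[of 0 1] by (simp add: a_def)
    next
      case (Suc k)
      have "\<kappa> i + \<mu> i \<le> a" using anti[of 1 i] Suc by (simp add: a_def)
      then have "J' \<inter> {..<\<kappa> i + \<mu> i} = J \<inter> {..<\<kappa> i + \<mu> i}" by (auto simp: J'_def)
      then show ?thesis using J[of k] Suc by simp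
    qed
    then show ?case by blast
  qed
  then show thesis using that by blast
qed

text \<open>
  Some columns of a tableau, pushed together, form a tableau again. If its shape is \<open>\<kappa>\<close>, then its
  content satisfies the inequalities for \<open>\<kappa>\<close>; with all columns this is the converse of
  \<open>tableau_exists\<close>.
\<close>

lemma dominated_columns:
  assumes sh: "shape (card X) \<nu>" and T: "tableau \<nu> X T" and X: "finite X"
    and J: "\<And>i. card (J \<inter> {..<\<nu> i}) = \<kappa> i"
  shows "dominated \<kappa> X (\<lambda>k. card {(i, j) \<in> boxes \<nu>. j \<in> J \<and> T i j = k})"
proof -
  have wt: "(\<Sum>k\<in>S. card {(i, j) \<in> boxes \<nu>. j \<in> J \<and> T i j = k})
      = card {(i, j) \<in> boxes \<nu>. j \<in> J \<and> T i j \<in> S}" if "finite S" for S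
  proof -
    have "{(i, j) \<in> boxes \<nu>. j \<in> J \<and> T i j \<in> S}
      = (\<Union>k\<in>S. {(i, j) \<in> boxes \<nu>. j \<in> J \<and> T i j = k})" by auto
    then show ?thesis
      using that finite_boxes[OF sh]
      by (simp only:) (intro card_UN_disjoint[symmetric]; force intro: finite_subset[of _ "boxes \<nu>"])
  qed
  have "{(i, j) \<in> boxes \<nu>. j \<in> J \<and> T i j \<in> X} = (SIGMA i:{..<card X}. J \<inter> {..<\<nu> i})"
    unfolding boxes_Sigma[OF sh] using T by (auto simp: tableau_def)
  then have "card {(i, j) \<in> boxes \<nu>. j \<in> J \<and> T i j \<in> X} = sum \<kappa> {..<card X}"
    using J by simp
  then show ?thesis
    using entries_in_columns_le[OF sh T, of _ J] wt finite_subset[OF _ X] X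
    by (simp add: dominated_def J)
qed

text \<open>
  The permutohedra of \<open>\<kappa>\<close> and \<open>\<mu>\<close> have the permutohedron of \<open>\<kappa> + \<mu>\<close> as their sum, even on the level of
  lattice points: distribute the columns of a tableau of shape \<open>\<kappa> + \<mu>\<close>.
\<close>

lemma dominated_add_split:
  fixes X :: "'a::linorder set"
  assumes X: "finite X" and \<kappa>: "shape (card X) \<kappa>" and \<mu>: "shape (card X) \<mu>"
    and dom: "dominated (\<lambda>i. \<kappa> i + \<mu> i) X \<gamma>"
  obtains a b where "dominated \<kappa> X a" "dominated \<mu> X b" "\<And>k. k \<in> X \<Longrightarrow> \<gamma> k = a k + b k"
proof -
  define \<nu> where "\<nu> i = \<kappa> i + \<mu> i" for i
  have sh: "shape (card X) \<nu>"
    using \<kappa> \<mu> by (auto simp: shape_def \<nu>_def antimono_def add_mono)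
  obtain T where T: "tableau \<nu> X T"
    and wt: "\<And>k. k \<in> X \<Longrightarrow> card {(i, j) \<in> boxes \<nu>. T i j = k} = \<gamma> k"
    using tableau_exists[OF X sh dom[folded \<nu>_def]] by blast
  obtain J where J: "\<And>i. card (J \<inter> {..<\<nu> i}) = \<kappa> i"
    using split_columns[OF \<kappa> \<mu>] unfolding \<nu>_def by blast
  have J': "card (- J \<inter> {..<\<nu> i}) = \<mu> i" for i
  proof -
    have "card {..<\<nu> i} = card (J \<inter> {..<\<nu> i}) + card (- J \<inter> {..<\<nu> i})"
      using card_Int_Diff[of "{..<\<nu> i}" J] by (simp add: Diff_eq Int_commute)
    then show ?thesis using J[of i] by (simp add: \<nu>_def)
  qed
  show thesis
  proof (rule that[OF dominated_columns[OF sh T X J] dominated_columns[OF sh T X J']])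
    fix k assume "k \<in> X"
    then have "\<gamma> k = card {(i, j) \<in> boxes \<nu>. T i j = k}" using wt by simp
    also have "{(i, j) \<in> boxes \<nu>. T i j = k} = {(i, j) \<in> boxes \<nu>. j \<in> J \<and> T i j = k}
        \<union> {(i, j) \<in> boxes \<nu>. j \<in> - J \<and> T i j = k}"
      by auto
    also have "card \<dots> = card {(i, j) \<in> boxes \<nu>. j \<in> J \<and> T i j = k}
        + card {(i, j) \<in> boxes \<nu>. j \<in> - J \<and> T i j = k}"
      using finite_boxes[OF sh]
      by (intro card_Un_disjoint) (auto intro: finite_subset[of _ "boxes \<nu>"])
    finally show "\<gamma> k = card {(i, j) \<in> boxes \<nu>. j \<in> J \<and> T i j = k}
        + card {(i, j) \<in> boxes \<nu>. j \<in> - J \<and> T i j = k}" .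
  qed
qed

lemma dominated_sum_split:
  fixes X :: "'a::linorder set" and t :: nat
  assumes X: "finite X" and sh: "\<And>j. j < t \<Longrightarrow> shape (card X) (L j)"
    and dom: "dominated (\<lambda>i. \<Sum>j<t. L j i) X \<gamma>"
  obtains v where "\<And>j. j < t \<Longrightarrow> dominated (L j) X (v j)"
    "\<And>k. k \<in> X \<Longrightarrow> \<gamma> k = (\<Sum>j<t. v j k)"
  using sh dom
proof (induction t arbitrary: \<gamma> thesis)
  case 0
  then show ?case using X by (auto simp: dominated_def)
next
  case (Suc t)
  have "shape (card X) (\<lambda>i. \<Sum>j<t. L j i)"
    using Suc.prems(2) by (auto simp: shape_def antimono_def intro!: sum_mono)
  then obtain a b where ab: "dominated (\<lambda>i. \<Sum>j<t. L j i) X a" "dominated (L t) X b"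
    "\<And>k. k \<in> X \<Longrightarrow> \<gamma> k = a k + b k"
    using dominated_add_split[OF X, of "\<lambda>i. \<Sum>j<t. L j i" "L t" \<gamma>] Suc.prems by auto
  obtain v where v: "\<And>j. j < t \<Longrightarrow> dominated (L j) X (v j)" "\<And>k. k \<in> X \<Longrightarrow> a k = (\<Sum>j<t. v j k)"
    using Suc.IH[OF _ _ ab(1)] Suc.prems(2) by (metis less_Suc_eq)
  show ?case
    by (rule Suc.prems(1)[of "v(t := b)"]) (use v ab in \<open>auto simp: less_Suc_eq\<close>)
qed


section \<open>Exponents of Schur polynomials\<close>

definition row_index :: "'m::{finite,linorder} \<Rightarrow> nat" where
  "row_index i = card {..<i}"

lemma row_index_less_iff:
  fixes i j :: "'m::{finite,linorder}"
  shows "row_index i < row_index j \<longleftrightarrow> i < j"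
proof -
  have "row_index i < row_index j" if "i < j" for i j :: 'm
    unfolding row_index_def using that by (intro psubset_card_mono) auto
  then show ?thesis by (metis less_asym linorder_neqE)
qed

lemma row_index_le_iff: "row_index i \<le> row_index j \<longleftrightarrow> i \<le> j"
  using row_index_less_iff[of j i] by (simp add: not_less[symmetric])

lemma row_index_eq_iff: "row_index i = row_index j \<longleftrightarrow> i = j"
  by (metis order_eq_iff row_index_le_iff)

lemma range_row_index: "range (row_index :: 'm::{finite,linorder} \<Rightarrow> nat) = {..<CARD('m)}"
proof (rule card_subset_eq)
  show "range (row_index :: 'm \<Rightarrow> nat) \<subseteq> {..<CARD('m)}"
    by (auto simp: row_index_def intro!: psubset_card_mono)
  show "card (range (row_index :: 'm \<Rightarrow> nat)) = card {..<CARD('m)}"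
    by (simp add: card_image inj_def row_index_eq_iff)
qed simp

lemma row_index_less_CARD: "row_index (i::'m::{finite,linorder}) < CARD('m)"
  using range_row_index by blast

lemma row_index_surj:
  assumes "k < CARD('m::{finite,linorder})"
  obtains i :: "'m::{finite,linorder}" where "row_index i = k"
  using assms range_row_index[where 'm='m] by (metis imageE lessThan_iff)

text \<open>
  At most one \<open>i\<close> has row index \<open>k\<close>; the sum picks its part and gives 0 below the last row.
\<close>

definition row_lengths :: "nat^('m::{finite,linorder}) \<Rightarrow> nat \<Rightarrow> nat" where
  "row_lengths \<mu> k = (\<Sum>i | row_index i = k. \<mu> $ i)"

lemma row_lengths_row_index [simp]: "row_lengths \<mu> (row_index i) = \<mu> $ i"
  by (simp add: row_lengths_def row_index_eq_iff)

lemma row_lengths_beyond: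
  fixes \<mu> :: "nat^('m::{finite,linorder})"
  shows "CARD('m) \<le> k \<Longrightarrow> row_lengths \<mu> k = 0"
  using row_index_less_CARD[where 'm='m] by (auto simp: row_lengths_def dest: leD)

lemma row_lengths_nonzero:
  fixes \<mu> :: "nat^('m::{finite,linorder})"
  assumes "row_lengths \<mu> k \<noteq> 0"
  obtains i :: 'm where "row_index i = k"
proof -
  have "k < CARD('m)" using assms row_lengths_beyond[of k \<mu>] by (meson not_le)
  then show thesis using that row_index_surj by blast
qed

lemma shape_row_lengths:
  fixes \<mu> :: "nat^('m::{finite,linorder})"
  assumes "is_partition \<mu>"
  shows "shape CARD('m) (row_lengths \<mu>)"
  unfolding shape_def antimono_def
proof (intro conjI allI impI row_lengths_beyond)
  fix k l :: nat assume kl: "k \<le> l"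
  show "row_lengths \<mu> l \<le> row_lengths \<mu> k"
  proof (cases "l < CARD('m)")
    case True
    then have "k < CARD('m)" using kl by simp
    then obtain i j :: 'm where "row_index i = k" "row_index j = l"
      using True row_index_surj by metis
    then show ?thesis using assms kl row_index_le_iff[of i j] by (auto simp: is_partition_def)
  qed (simp add: row_lengths_beyond)
qed

lemma sum_row_lengths_lessThan: "sum (row_lengths \<mu>) {..<c} = (\<Sum>i | row_index i < c. \<mu> $ i)"
proof -
  have "(\<Sum>i | row_index i < c. \<mu> $ i) = (\<Sum>k<c. \<Sum>i | i \<in> {i. row_index i < c} \<and> row_index i = k. \<mu> $ i)"
    by (rule sum.group[symmetric]) auto
  also have "\<dots> = sum (row_lengths \<mu>) {..<c}"
    unfolding row_lengths_def by (intro sum.cong) auto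
  finally show ?thesis ..
qed

lemma sum_row_lengths_total:
  fixes \<mu> :: "nat^('m::{finite,linorder})"
  shows "sum (row_lengths \<mu>) {..<CARD('m)} = psize \<mu>"
  by (simp add: sum_row_lengths_lessThan psize_def row_index_less_CARD)

text \<open>
  Dominance compares partial sums over initial segments of the index type, which become the nonempty
  initial segments of row numbers; beyond the last row both partial sums are the common size.
\<close>

lemma dominates_sum_row_lengths:
  fixes \<mu> \<nu> :: "nat^('m::{finite,linorder})"
  assumes "dominates \<mu> \<nu>"
  shows "sum (row_lengths \<nu>) {..<c} \<le> sum (row_lengths \<mu>) {..<c}"
proof (cases "c = 0 \<or> CARD('m) \<le> c")
  case True
  then consider "c = 0" | "CARD('m) \<le> c" by blast
  then show ?thesis
  proof cases
    case 2
    then have "{i::'m. row_index i < c} = UNIV" using row_index_less_CARD by (auto intro: less_le_trans)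
    then show ?thesis using assms by (simp add: sum_row_lengths_lessThan dominates_def psize_def)
  qed simp
next
  case False
  then have "c - 1 < CARD('m)" by linarith
  then obtain j :: 'm where j: "row_index j = c - 1"
    using row_index_surj[where 'm='m] by blast
  have "{i. row_index i < c} = {..j}"
    using False by (auto simp: row_index_le_iff[symmetric] j)
  then show ?thesis using assms by (simp add: sum_row_lengths_lessThan dominates_def)
qed

lemma dominated_mono:
  fixes \<mu> \<nu> :: "nat^('m::{finite,linorder})" and \<gamma> :: "'m \<Rightarrow> nat"
  assumes "dominates \<mu> \<nu>" "dominated (row_lengths \<nu>) UNIV \<gamma>"
  shows "dominated (row_lengths \<mu>) UNIV \<gamma>"
  unfolding dominated_def
proof (intro conjI allI impI)
  fix S :: "'m set"
  have "sum \<gamma> S \<le> sum (row_lengths \<nu>) {..<card S}" using assms(2) by (simp add: dominated_def)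
  then show "sum \<gamma> S \<le> sum (row_lengths \<mu>) {..<card S}"
    using dominates_sum_row_lengths[OF assms(1)] le_trans by blast
next
  show "sum \<gamma> UNIV = sum (row_lengths \<mu>) {..<CARD('m)}"
    using assms by (simp add: dominated_def sum_row_lengths_total dominates_def)
qed

lemma keys_schur_content: "Poly_Mapping.keys (schur \<mu>) = content \<mu> ` ssyt \<mu>"
proof -
  have "Poly_Mapping.lookup (schur \<mu>) \<gamma> = of_nat (card {T \<in> ssyt \<mu>. content \<mu> T = \<gamma>})" for \<gamma>
    by (simp add: schur_def lookup_sum lookup_single when_def sum.If_cases finite_ssyt Int_def)
  then show ?thesis
    by (auto simp: Poly_Mapping.in_keys_iff finite_ssyt)
qed

lemma card_boxes_row_lengths:
  fixes \<mu> :: "nat^('m::{finite,linorder})"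
  assumes "\<And>i j. j < \<mu> $ i \<Longrightarrow> T (i, j) = T' (row_index i) j"
  shows "card {b \<in> diagram \<mu>. T b = k} = card {(i, j) \<in> boxes (row_lengths \<mu>). T' i j = k}"
proof (rule bij_betw_same_card[of "\<lambda>(i, j). (row_index i, j)"])
  show "bij_betw (\<lambda>(i, j). (row_index i, j)) {b \<in> diagram \<mu>. T b = k}
      {(i, j) \<in> boxes (row_lengths \<mu>). T' i j = k}"
    unfolding bij_betw_def
  proof (intro conjI set_eqI iffI)
    show "inj_on (\<lambda>(i, j). (row_index i, j)) {b \<in> diagram \<mu>. T b = k}"
      by (auto simp: inj_on_def row_index_eq_iff)
  next
    fix b assume "b \<in> (\<lambda>(i, j). (row_index i, j)) ` {b \<in> diagram \<mu>. T b = k}"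
    then show "b \<in> {(i, j) \<in> boxes (row_lengths \<mu>). T' i j = k}"
      using assms by (auto simp: diagram_def boxes_def)
  next
    fix b assume "b \<in> {(i, j) \<in> boxes (row_lengths \<mu>). T' i j = k}"
    then obtain r j where b: "b = (r, j)" "j < row_lengths \<mu> r" "T' r j = k"
      by (auto simp: boxes_def)
    then obtain i :: 'm where i: "row_index i = r"
      using row_lengths_nonzero by (metis less_nat_zero_code)
    then have "(i, j) \<in> {b \<in> diagram \<mu>. T b = k}"
      using b assms by (auto simp: diagram_def)
    then show "b \<in> (\<lambda>(i, j). (row_index i, j)) ` {b \<in> diagram \<mu>. T b = k}"
      using b i by force
  qed
qed

text \<open>
  A sum over tableaux has no cancellation, so the exponents are the contents of tableaux. Only the rows
  have to be renumbered to apply the results about tableaux; the letters stay what they are.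
\<close>

theorem keys_schur:
  fixes \<mu> :: "nat^('m::{finite,linorder})"
  assumes \<mu>: "is_partition \<mu>"
  shows "Poly_Mapping.keys (schur \<mu>) = {\<gamma>. dominated (row_lengths \<mu>) UNIV (vec_nth \<gamma>)}"
proof (intro set_eqI iffI)
  note sh = shape_row_lengths[OF \<mu>]
  fix \<gamma> assume "\<gamma> \<in> Poly_Mapping.keys (schur \<mu>)"
  then obtain T where T: "T \<in> ssyt \<mu>" and \<gamma>: "\<gamma> = content \<mu> T"
    by (auto simp: keys_schur_content)
  define T' where "T' k j = T (inv row_index k, j)" for k j
  have inv: "inv row_index (row_index i) = i" for i :: 'm
    by (simp add: inj_def row_index_eq_iff)
  have ex: "\<exists>i::'m. row_index i = k" if "j < row_lengths \<mu> k" for j k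
    using that row_lengths_nonzero[of \<mu> k] by auto
  have "tableau (row_lengths \<mu>) UNIV T'"
    unfolding tableau_def
  proof (intro conjI allI impI UNIV_I; elim conjE)
    fix k j j' assume jj: "j < j'" "j' < row_lengths \<mu> k"
    then obtain i :: 'm where "row_index i = k" using ex by blast
    then show "T' k j \<le> T' k j'"
      using jj T by (auto simp: T'_def inv ssyt_def diagram_def)
  next
    fix k k' j assume kk: "k < k'" "j < row_lengths \<mu> k'"
    moreover have "j < row_lengths \<mu> k"
      using kk shape_antimonoD[OF sh, of k k'] by simp
    ultimately obtain i i' :: 'm where "row_index i = k" "row_index i' = k'" "j < \<mu> $ i" "j < \<mu> $ i'"
      using ex row_lengths_row_index by metis
    moreover have "i < i'" using kk calculation row_index_less_iff[of i i'] by simp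
    ultimately show "T' k j < T' k' j"
      using T by (auto simp: T'_def inv ssyt_def diagram_def)
  qed
  then have "dominated (row_lengths \<mu>) UNIV (\<lambda>l. card {(k, j) \<in> boxes (row_lengths \<mu>). j \<in> UNIV \<and> T' k j = l})"
    using sh by (intro dominated_columns) auto
  moreover have "vec_nth \<gamma> = (\<lambda>l. card {(k, j) \<in> boxes (row_lengths \<mu>). j \<in> UNIV \<and> T' k j = l})"
    using card_boxes_row_lengths[of \<mu> T T'] by (auto simp: \<gamma> content_def T'_def inv fun_eq_iff)
  ultimately show "\<gamma> \<in> {\<gamma>. dominated (row_lengths \<mu>) UNIV (vec_nth \<gamma>)}" by simp
next
  fix \<gamma> :: "nat^('m::{finite,linorder})"
  assume "\<gamma> \<in> {\<gamma>. dominated (row_lengths \<mu>) UNIV (vec_nth \<gamma>)}"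
  then obtain T' where T': "tableau (row_lengths \<mu>) UNIV T'"
    and wt: "\<And>l. card {(i, j) \<in> boxes (row_lengths \<mu>). T' i j = l} = \<gamma> $ l"
    using tableau_exists[of UNIV "row_lengths \<mu>" "vec_nth \<gamma>"] shape_row_lengths[OF \<mu>] by auto
  define T where "T = restrict (\<lambda>(i, j). T' (row_index i) j) (diagram \<mu>)"
  have "T \<in> ssyt \<mu>"
    using T' unfolding ssyt_def
    by (auto simp: T_def diagram_def tableau_def row_index_less_iff)
  moreover have "content \<mu> T = \<gamma>"
    using card_boxes_row_lengths[of \<mu> T T'] wt by (auto simp: content_def vec_eq_iff T_def diagram_def)
  ultimately show "\<gamma> \<in> Poly_Mapping.keys (schur \<mu>)"
    by (auto simp: keys_schur_content)
qed


section \<open>Brackets and the chain of maximal partitions\<close>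

lemma keys_schur_psize:
  assumes "is_partition \<mu>" "\<gamma> \<in> Poly_Mapping.keys (schur \<mu>)"
  shows "psize \<gamma> = psize \<mu>"
  using assms by (simp add: keys_schur dominated_def sum_row_lengths_total psize_def)

lemma keys_bracket_psize:
  assumes "\<forall>\<mu>. C \<mu> \<noteq> 0 \<longrightarrow> is_partition \<mu>" "\<gamma> \<in> Poly_Mapping.keys (bracket C d)"
  shows "psize \<gamma> = d"
proof -
  obtain \<mu> where \<mu>: "\<mu> \<in> bracket_index C d"
    and "\<gamma> \<in> Poly_Mapping.keys (Poly_Mapping.single 0 (C \<mu>) * schur \<mu>)"
    using assms(2) Poly_Mapping.keys_sum unfolding bracket_def by fast
  then have "\<gamma> \<in> Poly_Mapping.keys (schur \<mu>)"
    using Poly_Mapping.keys_mult[of "Poly_Mapping.single 0 (C \<mu>)" "schur \<mu>"]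
    by (auto split: if_splits)
  then show ?thesis
    using keys_schur_psize[of \<mu> \<gamma>] \<mu> assms(1) by (simp add: bracket_index_def)
qed

lemma schur_comb_brackets:
  assumes "finite {\<mu>. C \<mu> \<noteq> 0}"
  shows "schur_comb C = (\<Sum>d\<in>degrees C. bracket C d)"
proof -
  have "bracket_index C d = {\<mu> \<in> {\<mu>. C \<mu> \<noteq> 0}. psize \<mu> = d}" for d
    by (auto simp: bracket_index_def)
  then show ?thesis
    unfolding schur_comb_def bracket_def degrees_def
    using assms by (simp only:) (rule sum.group[symmetric]; simp)
qed

lemma bracket_eq_0:
  assumes "d \<notin> degrees C"
  shows "bracket C d = 0"
proof -
  have "bracket_index C d = {}" using assms by (auto simp: degrees_def bracket_index_def)
  then show ?thesis by (simp add: bracket_def)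
qed

text \<open>
  Brackets of different degrees have no common exponents, so nothing cancels between them.
\<close>

lemma keys_schur_comb:
  assumes fin: "finite {\<mu>. C \<mu> \<noteq> 0}" and part: "\<forall>\<mu>. C \<mu> \<noteq> 0 \<longrightarrow> is_partition \<mu>"
  shows "\<gamma> \<in> Poly_Mapping.keys (schur_comb C) \<longleftrightarrow> \<gamma> \<in> Poly_Mapping.keys (bracket C (psize \<gamma>))"
proof -
  have *: "Poly_Mapping.lookup (bracket C d) \<gamma> = 0" if "d \<noteq> psize \<gamma>" for d
    using keys_bracket_psize[where C=C and \<gamma>=\<gamma> and d=d, OF part] that by (auto simp: Poly_Mapping.in_keys_iff)
  have "finite (degrees C)" using fin by (simp add: degrees_def)
  then have "Poly_Mapping.lookup (schur_comb C) \<gamma>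
      = (\<Sum>d\<in>degrees C \<union> {psize \<gamma>}. Poly_Mapping.lookup (bracket C d) \<gamma>)"
    unfolding schur_comb_brackets[OF fin] lookup_sum
    using bracket_eq_0[of "psize \<gamma>" C] by (intro sum.mono_neutral_left) auto
  also have "\<dots> = (\<Sum>d\<in>{psize \<gamma>}. Poly_Mapping.lookup (bracket C d) \<gamma>)"
    using * \<open>finite (degrees C)\<close> by (intro sum.mono_neutral_right) auto
  finally show ?thesis by (simp add: Poly_Mapping.in_keys_iff)
qed

text \<open>
  The partitions that occur when the rows of \<open>\<alpha>\<close> are filled up to \<open>\<beta>\<close> from the top: if a row is not
  yet full, then no box has been added below it.
\<close>

definition greedy ::
  "nat^('m::{finite,linorder}) \<Rightarrow> nat^('m::{finite,linorder}) \<Rightarrow> nat^('m::{finite,linorder}) \<Rightarrow> bool" where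
  "greedy \<alpha> \<beta> \<mu> \<longleftrightarrow> is_partition \<mu> \<and> \<alpha> \<le> \<mu> \<and> \<mu> \<le> \<beta> \<and>
     (\<forall>r s. r < s \<longrightarrow> \<mu> $ r = \<beta> $ r \<or> \<mu> $ s = \<alpha> $ s)"

lemma axis_nth_if: "axis r c $ i = (if i = r then c else 0)"
  by (auto simp: axis_def)

text \<open>
  If a row above the row \<open>r\<close> of the new box were not full, then the topmost such row \<open>a\<close> could take a box:
  the rows above \<open>a\<close> agree with \<open>\<beta>\<close>, so they are long enough for the result to be a diagram. This
  contradicts the choice of \<open>r\<close> as the topmost admissible row.
\<close>

lemma greedy_add_box:
  fixes \<alpha> \<beta> \<mu> \<nu> :: "nat^('m::{finite,linorder})"
  assumes \<mu>: "greedy \<alpha> \<beta> \<mu>" and \<beta>: "is_partition \<beta>" and add: "adds_northmost_box \<alpha> \<beta> \<mu> \<nu>"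
  shows "greedy \<alpha> \<beta> \<nu>" "psize \<nu> = Suc (psize \<mu>)"
proof -
  obtain r where adm: "admissible_row \<alpha> \<beta> \<mu> r"
    and least: "\<And>r'. admissible_row \<alpha> \<beta> \<mu> r' \<Longrightarrow> r \<le> r'" and \<nu>: "\<nu> = \<mu> + axis r 1"
    using add by (auto simp: adds_northmost_box_def)
  have \<nu>_nth: "\<nu> $ i = (if i = r then Suc (\<mu> $ i) else \<mu> $ i)" for i
    by (simp add: \<nu> axis_nth_if)
  have le: "\<alpha> $ i \<le> \<mu> $ i" "\<mu> $ i \<le> \<beta> $ i" "\<nu> $ i \<le> \<beta> $ i" for i
    using \<mu> adm by (auto simp: greedy_def less_eq_vec_def admissible_row_def \<nu>)
  have full: "\<mu> $ i = \<beta> $ i" if "i < r" for i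
  proof (rule ccontr)
    assume "\<mu> $ i \<noteq> \<beta> $ i"
    define A where "A = {i. \<mu> $ i \<noteq> \<beta> $ i}"
    define a where "a = Min A"
    have "i \<in> A" using \<open>\<mu> $ i \<noteq> \<beta> $ i\<close> by (simp add: A_def)
    then have a: "a \<in> A" "a \<le> i" unfolding a_def by (auto intro: Min_in)
    then have lt: "\<mu> $ a < \<beta> $ a" using le(2)[of a] by (simp add: A_def)
    have above: "\<mu> $ k = \<beta> $ k" if "k < a" for k
    proof -
      have "k \<notin> A" using that Min_le[of A k] by (auto simp flip: a_def)
      then show ?thesis by (simp add: A_def)
    qed
    have "is_partition (\<mu> + axis a 1)"
      unfolding is_partition_def
    proof (intro allI impI)
      fix k l :: 'm assume kl: "k \<le> l"
      have "\<mu> $ l \<le> \<mu> $ k" using \<mu> kl by (auto simp: greedy_def is_partition_def)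
      moreover have "Suc (\<mu> $ a) \<le> \<mu> $ k" if "l = a" "k \<noteq> a"
      proof -
        have "\<beta> $ a \<le> \<beta> $ k" using \<beta> kl that by (auto simp: is_partition_def)
        then show ?thesis using above[of k] lt kl that by simp
      qed
      ultimately show "(\<mu> + axis a 1) $ l \<le> (\<mu> + axis a 1) $ k"
        by (auto simp: axis_nth_if)
    qed
    moreover have "\<alpha> < \<mu> + axis a 1"
      using le(1) by (auto simp: less_vec_def less_eq_vec_def axis_nth_if not_le
          intro!: exI[of _ a] le_SucI le_imp_less_Suc)
    moreover have "\<mu> + axis a 1 \<le> \<beta>"
      using le(2) lt by (auto simp: less_eq_vec_def axis_nth_if)
    ultimately have "r \<le> a" using least by (simp add: admissible_row_def)
    then show False using a that by simp
  qed
  have "\<nu> $ p = \<beta> $ p \<or> \<nu> $ q = \<alpha> $ q" if "p < q" for p q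
  proof -
    have "\<mu> $ p = \<beta> $ p \<or> \<mu> $ q = \<alpha> $ q" using \<mu> that by (auto simp: greedy_def)
    moreover have "\<mu> $ r < \<beta> $ r" using le(3)[of r] by (simp add: \<nu>_nth)
    ultimately show ?thesis using full[of p] that by (auto simp: \<nu>_nth)
  qed
  then show "greedy \<alpha> \<beta> \<nu>"
    using adm unfolding greedy_def admissible_row_def \<nu>[symmetric] by (simp add: less_imp_le)
  show "psize \<nu> = Suc (psize \<mu>)"
    by (simp add: psize_def \<nu> sum.distrib axis_nth_if)
qed

text \<open>
  Every Schur element of a bracket is dominated by the maximal one, whose exponents therefore include
  those of the whole bracket. Each added box raises the size by one, so the chain has a member of
  every size between those of its ends.
\<close>

lemma good_chain:
  fixes C :: "nat^('m::{finite,linorder}) \<Rightarrow> complex"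
  assumes fin: "finite {\<mu>. C \<mu> \<noteq> 0}" and part: "\<forall>\<mu>. C \<mu> \<noteq> 0 \<longrightarrow> is_partition \<mu>"
    and good: "good C"
  obtains \<alpha> \<beta> :: "nat^('m::{finite,linorder})" and l :: nat
    and \<Lambda> :: "nat \<Rightarrow> nat^('m::{finite,linorder})" where "\<And>i. i \<le> l \<Longrightarrow> greedy \<alpha> \<beta> (\<Lambda> i)"
    "\<And>i. i \<le> l \<Longrightarrow> psize (\<Lambda> i) = psize \<alpha> + i" "psize \<beta> = psize \<alpha> + l"
    "Poly_Mapping.keys (schur_comb C) =
      {\<gamma>. \<exists>i\<le>l. dominated (row_lengths (\<Lambda> i)) UNIV (vec_nth \<gamma>)}"
proof -
  obtain \<alpha> \<beta> :: "nat^('m::{finite,linorder})" and l :: nat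
    and \<Lambda> :: "nat \<Rightarrow> nat^('m::{finite,linorder})" where
    \<alpha>\<beta>: "is_partition \<alpha>" "is_partition \<beta>" "\<alpha> \<le> \<beta>" and
    max: "{\<mu>. \<exists>d \<in> degrees C. bracket_max C d \<mu>} = \<Lambda> ` {0..l}" and
    ends: "\<Lambda> 0 = \<alpha>" "\<Lambda> l = \<beta>" and
    step: "\<forall>i \<in> {1..l}. \<Lambda> (i - 1) < \<Lambda> i \<and> adds_northmost_box \<alpha> \<beta> (\<Lambda> (i - 1)) (\<Lambda> i)"
    using good unfolding good_def by (elim conjE exE) (rule that; assumption)
  have chain: "greedy \<alpha> \<beta> (\<Lambda> i) \<and> psize (\<Lambda> i) = psize \<alpha> + i" if "i \<le> l" for i
    using that
  proof (induction i)
    case 0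
    then show ?case using \<alpha>\<beta> ends by (simp add: greedy_def)
  next
    case (Suc i)
    then have \<Lambda>i: "greedy \<alpha> \<beta> (\<Lambda> i)" "psize (\<Lambda> i) = psize \<alpha> + i" by simp_all
    have "adds_northmost_box \<alpha> \<beta> (\<Lambda> i) (\<Lambda> (Suc i))" using step Suc.prems by force
    then show ?case using greedy_add_box[OF \<Lambda>i(1) \<alpha>\<beta>(2)] \<Lambda>i(2) by simp
  qed
  have keys: "Poly_Mapping.keys (bracket C d) =
      (\<Union>\<mu> \<in> bracket_index C d. Poly_Mapping.keys (schur \<mu>))" if "d \<in> degrees C" for d
    using good that unfolding good_def by blast
  have "\<gamma> \<in> Poly_Mapping.keys (schur_comb C) \<longleftrightarrow>
      (\<exists>i\<le>l. dominated (row_lengths (\<Lambda> i)) UNIV (vec_nth \<gamma>))" for \<gamma>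
  proof
    assume "\<gamma> \<in> Poly_Mapping.keys (schur_comb C)"
    then have \<gamma>: "\<gamma> \<in> Poly_Mapping.keys (bracket C (psize \<gamma>))"
      using keys_schur_comb[OF fin part] by blast
    then have d: "psize \<gamma> \<in> degrees C" using bracket_eq_0[of "psize \<gamma>" C] by force
    obtain \<mu> where \<mu>: "\<mu> \<in> bracket_index C (psize \<gamma>)" "\<gamma> \<in> Poly_Mapping.keys (schur \<mu>)"
      using keys[OF d] \<gamma> by blast
    obtain \<nu> where \<nu>: "bracket_max C (psize \<gamma>) \<nu>"
      using good d unfolding good_def by blast
    then have "\<nu> \<in> \<Lambda> ` {0..l}" using d unfolding max[symmetric] by blast
    then obtain i where i: "i \<le> l" "\<nu> = \<Lambda> i" by auto
    have "dominated (row_lengths \<mu>) UNIV (vec_nth \<gamma>)"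
      using \<mu> part by (simp add: bracket_index_def keys_schur)
    moreover have "dominates \<nu> \<mu>" using \<nu> \<mu>(1) by (simp add: bracket_max_def)
    ultimately show "\<exists>i\<le>l. dominated (row_lengths (\<Lambda> i)) UNIV (vec_nth \<gamma>)"
      using dominated_mono i by blast
  next
    assume "\<exists>i\<le>l. dominated (row_lengths (\<Lambda> i)) UNIV (vec_nth \<gamma>)"
    then obtain i where i: "i \<le> l" "dominated (row_lengths (\<Lambda> i)) UNIV (vec_nth \<gamma>)" by blast
    have "\<Lambda> i \<in> {\<mu>. \<exists>d \<in> degrees C. bracket_max C d \<mu>}" using max i by simp
    then obtain d where d: "d \<in> degrees C" "\<Lambda> i \<in> bracket_index C d"
      by (auto simp: bracket_max_def)
    have p: "is_partition (\<Lambda> i)" using chain[OF i(1)] by (simp add: greedy_def)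
    then have \<gamma>: "\<gamma> \<in> Poly_Mapping.keys (schur (\<Lambda> i))" using i by (simp add: keys_schur)
    then have "psize \<gamma> = d" using keys_schur_psize[OF p] d by (simp add: bracket_index_def)
    then show "\<gamma> \<in> Poly_Mapping.keys (schur_comb C)"
      using keys_schur_comb[OF fin part] keys d \<gamma> by blast
  qed
  then show thesis using that[of l \<alpha> \<beta> \<Lambda>] chain ends(2) by auto
qed

section \<open>Decomposition of lattice points\<close>

lemma greedy_bounds:
  fixes \<alpha> \<beta> \<mu> :: "nat^('m::{finite,linorder})"
  assumes "greedy \<alpha> \<beta> \<mu>"
  shows "row_lengths \<alpha> k \<le> row_lengths \<mu> k" "row_lengths \<mu> k \<le> row_lengths \<beta> k"
  using assms by (auto simp: row_lengths_def greedy_def less_eq_vec_def intro!: sum_mono)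

lemma greedy_cut:
  fixes \<alpha> \<beta> \<mu> :: "nat^('m::{finite,linorder})"
  assumes \<mu>: "greedy \<alpha> \<beta> \<mu>"
  shows "sum (row_lengths \<mu>) {..<c} = sum (row_lengths \<beta>) {..<c} \<or>
    sum (row_lengths \<mu>) {c..<n} = sum (row_lengths \<alpha>) {c..<n}"
proof (rule disjCI)
  assume *: "sum (row_lengths \<mu>) {c..<n} \<noteq> sum (row_lengths \<alpha>) {c..<n}"
  then obtain k where k: "c \<le> k" "row_lengths \<mu> k \<noteq> row_lengths \<alpha> k"
    by (metis atLeastLessThan_iff sum.cong)
  then have "row_lengths \<mu> k \<noteq> 0" using greedy_bounds(1)[OF \<mu>, of k] by auto
  then obtain s :: 'm where s: "row_index s = k" using row_lengths_nonzero by metis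
  have "row_lengths \<mu> q = row_lengths \<beta> q" if "q < c" for q
  proof (cases "row_lengths \<beta> q = 0")
    case True
    then show ?thesis using greedy_bounds(2)[OF \<mu>, of q] by simp
  next
    case False
    then obtain r :: 'm where r: "row_index r = q" using row_lengths_nonzero by metis
    then have "r < s" using s k that row_index_less_iff[of r s] by simp
    then have "\<mu> $ r = \<beta> $ r \<or> \<mu> $ s = \<alpha> $ s" using \<mu> by (simp add: greedy_def)
    then show ?thesis using k r s by (metis row_lengths_row_index)
  qed
  then show "sum (row_lengths \<mu>) {..<c} = sum (row_lengths \<beta>) {..<c}" by simp
qed

lemma sum_row_lengths_cut:
  fixes \<mu> :: "nat^('m::{finite,linorder})"
  assumes "c \<le> CARD('m)"
  shows "sum (row_lengths \<mu>) {..<c} + sum (row_lengths \<mu>) {c..<CARD('m)} = psize \<mu>"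
  using sum.atLeastLessThan_concat[of 0 c "CARD('m)" "row_lengths \<mu>"] assms
  by (simp add: sum_row_lengths_total[symmetric] atLeast0LessThan)

lemma balanced_summands:
  fixes e t l :: nat
  assumes "0 < t" "e \<le> t * l"
  obtains d :: "nat \<Rightarrow> nat" where "(\<Sum>j<t. d j) = e" "\<And>j. d j \<le> l" "\<And>i j. d i \<le> Suc (d j)"
proof -
  define d where "d j = e div t + (if j < e mod t then 1 else 0)" for j
  have "{..<t} \<inter> {j. j < e mod t} = {..<e mod t}" using assms(1) by (auto intro: less_trans)
  then have "(\<Sum>j<t. d j) = t * (e div t) + e mod t"
    by (simp add: d_def sum.distrib sum.If_cases)
  then have "(\<Sum>j<t. d j) = e" by simp
  moreover have "d j \<le> l" for j
  proof (cases "e = t * l")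
    case True
    then show ?thesis using assms(1) by (simp add: d_def)
  next
    case False
    then have "e div t < l" using assms by (simp add: div_less_iff_less_mult mult.commute)
    then show ?thesis by (simp add: d_def)
  qed
  ultimately show thesis using that[of d] by (simp add: d_def)
qed

text \<open>
  The members \<open>\<Lambda> (i j)\<close> are chosen with sizes as equal as possible. Let \<open>c = card S\<close>. If one of them had
  a first part (the first \<open>c\<close> rows) smaller than that of \<open>\<beta>\<close> and another one a remainder larger than that
  of \<open>\<alpha>\<close>, then by \<open>greedy_cut\<close> their sizes would differ by at least two. So all of them
  agree with \<open>\<beta>\<close> in the first \<open>c\<close> rows, and the upper bound for \<open>p\<close> on \<open>S\<close> gives the inequality needed; or all of
  them agree with \<open>\<alpha>\<close> in the remaining rows, and the lower bound for \<open>p\<close> on the complement of \<open>S\<close>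
  does so.
\<close>

lemma chain_decomposition:
  fixes \<alpha> \<beta> :: "nat^('m::{finite,linorder})" and p :: "'m \<Rightarrow> nat"
  assumes t: "0 < t"
    and greedy: "\<And>i. i \<le> l \<Longrightarrow> greedy \<alpha> \<beta> (\<Lambda> i)"
    and size: "\<And>i. i \<le> l \<Longrightarrow> psize (\<Lambda> i) = psize \<alpha> + i" and size_\<beta>: "psize \<beta> = psize \<alpha> + l"
    and upper: "\<And>S. sum p S \<le> t * sum (row_lengths \<beta>) {..<card S}"
    and lower: "\<And>S. t * sum (row_lengths \<alpha>) {CARD('m) - card S..<CARD('m)} \<le> sum p S"
  obtains i v where "\<And>j. j < t \<Longrightarrow> i j \<le> l"
    "\<And>j. j < t \<Longrightarrow> dominated (row_lengths (\<Lambda> (i j))) UNIV (v j)"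
    "\<And>k. p k = (\<Sum>j<t. v j k)"
proof -
  have "sum p UNIV \<le> t * psize \<beta>" "t * psize \<alpha> \<le> sum p UNIV"
    using upper[of UNIV] lower[of UNIV] by (simp_all add: sum_row_lengths_total atLeast0LessThan)
  then have "sum p UNIV - t * psize \<alpha> \<le> t * l" and
    p_ge: "t * psize \<alpha> \<le> sum p UNIV" by (simp_all add: size_\<beta> algebra_simps)
  then obtain i where i_sum: "(\<Sum>j<t. i j) = sum p UNIV - t * psize \<alpha>"
    and i_le: "\<And>j. i j \<le> l" and i_close: "\<And>j k. i j \<le> Suc (i k)"
    using balanced_summands[OF t] by metis
  define L where "L j = row_lengths (\<Lambda> (i j))" for j
  have L_total: "sum (L j) {..<CARD('m)} = psize \<alpha> + i j" for j
    using size[OF i_le] by (simp add: L_def sum_row_lengths_total)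
  have total: "(\<Sum>j<t. sum (L j) {..<CARD('m)}) = sum p UNIV"
    using i_sum p_ge by (simp add: L_total sum.distrib)
  have "dominated (\<lambda>k. \<Sum>j<t. L j k) UNIV p"
    unfolding dominated_def
  proof (intro conjI allI impI)
    show "sum p UNIV = (\<Sum>k<CARD('m). \<Sum>j<t. L j k)"
      using total by (subst sum.swap) simp
    fix S :: "'m set"
    define c where "c = card S"
    have c: "c \<le> CARD('m)" unfolding c_def by (intro card_mono) auto
    define A where "A = sum (row_lengths \<alpha>) {c..<CARD('m)}"
    define B where "B = sum (row_lengths \<beta>) {..<c}"
    define f where "f j = sum (L j) {..<c}" for j
    define g where "g j = sum (L j) {c..<CARD('m)}" for j
    have fg: "f j + g j = psize \<alpha> + i j" for j
      using sum_row_lengths_cut[OF c, of "\<Lambda> (i j)"] size[OF i_le] by (simp add: f_def g_def L_def)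
    have fB: "f j \<le> B" for j
      unfolding f_def B_def L_def by (intro sum_mono greedy_bounds(2)[OF greedy[OF i_le]])
    have gA: "A \<le> g j" for j
      unfolding g_def A_def L_def by (intro sum_mono greedy_bounds(1)[OF greedy[OF i_le]])
    have cut: "f j = B \<or> g j = A" for j
      using greedy_cut[OF greedy[OF i_le]] by (simp add: f_def g_def A_def B_def L_def)
    have "(\<forall>j. f j = B) \<or> (\<forall>j. g j = A)"
    proof (rule ccontr)
      assume "\<not> ?thesis"
      then obtain j k where "f j \<noteq> B" "g k \<noteq> A" by blast
      then have "f j < B" "g j = A" "A < g k" "f k = B"
        using cut[of j] cut[of k] fB[of j] gA[of k] by auto
      then show False using fg[of j] fg[of k] i_close[of k j] by linarith
    qed
    then have "sum p S \<le> (\<Sum>j<t. f j)"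
    proof
      assume "\<forall>j. f j = B"
      then show ?thesis using upper[of S] by (simp add: B_def c_def)
    next
      assume g: "\<forall>j. g j = A"
      have "card (- S) = CARD('m) - c" by (simp add: c_def Compl_eq_Diff_UNIV card_Diff_subset)
      then have "t * A \<le> sum p (- S)" using lower[of "- S"] c by (simp add: A_def)
      moreover have "sum p S + sum p (- S) = sum p UNIV"
        by (simp add: sum.union_disjoint[symmetric])
      moreover have "(\<Sum>j<t. f j) + (\<Sum>j<t. g j) = sum p UNIV"
        using total by (simp add: sum.distrib[symmetric] fg L_total)
      ultimately show ?thesis using g by simp
    qed
    then show "sum p S \<le> (\<Sum>k<card S. \<Sum>j<t. L j k)"
      by (subst sum.swap) (simp add: f_def c_def)
  qed
  moreover have "shape CARD('m) (L j)" for j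
    using greedy[OF i_le] by (simp add: L_def shape_row_lengths greedy_def)
  ultimately obtain v where "\<And>j. j < t \<Longrightarrow> dominated (L j) UNIV (v j)" "\<And>k. p k = (\<Sum>j<t. v j k)"
    using dominated_sum_split[of UNIV t L p] by auto
  then show thesis using that[of i v] i_le by (simp add: L_def)
qed

lemma convex_sum_coordinates_box:
  fixes a b :: "'m::finite set \<Rightarrow> real"
  shows "convex {x :: real^'m. \<forall>S. a S \<le> (\<Sum>i\<in>S. x $ i) \<and> (\<Sum>i\<in>S. x $ i) \<le> b S}"
proof -
  have "{x :: real^'m. \<forall>S. a S \<le> (\<Sum>i\<in>S. x $ i) \<and> (\<Sum>i\<in>S. x $ i) \<le> b S}
      = (\<Inter>S. (\<lambda>x. \<Sum>i\<in>S. x $ i) -` {a S..b S})"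
    by auto
  moreover have "linear (\<lambda>x :: real^'m. \<Sum>i\<in>S. x $ i)" for S
    by (rule linearI) (simp_all add: sum.distrib sum_distrib_left)
  ultimately show ?thesis
    by (simp only:) (intro convex_INT convex_linear_vimage convex_real_interval)
qed

text \<open>
  The set \<open>Q\<close> in the proof contains the exponents: the upper bound follows from \<open>\<Lambda> i \<le> \<beta>\<close>, the lower one
  from the upper bound on the complement and \<open>\<alpha> \<le> \<Lambda> i\<close>. Being convex, it contains the Newton polytope,
  and scaling by \<open>t\<close> gives the bounds required by \<open>chain_decomposition\<close>.
\<close>

lemma newton_decomposition:
  fixes C :: "nat^('m::{finite,linorder}) \<Rightarrow> complex"
  assumes fin: "finite {\<mu>. C \<mu> \<noteq> 0}" and part: "\<forall>\<mu>. C \<mu> \<noteq> 0 \<longrightarrow> is_partition \<mu>"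
    and good: "good C" and t: "0 < t"
    and x: "x \<in> Newton (schur_comb C)" and lattice: "real t *\<^sub>R x \<in> lattice_points"
  obtains v where "\<And>j. j < t \<Longrightarrow> v j \<in> Poly_Mapping.keys (schur_comb C)"
    "real t *\<^sub>R x = (\<Sum>j<t. real_vec (v j))"
proof (rule good_chain[OF fin part good])
  fix \<alpha> \<beta> :: "nat^('m::{finite,linorder})" and l :: nat
    and \<Lambda> :: "nat \<Rightarrow> nat^('m::{finite,linorder})"
  assume greedy: "\<And>i. i \<le> l \<Longrightarrow> greedy \<alpha> \<beta> (\<Lambda> i)"
    and size: "\<And>i. i \<le> l \<Longrightarrow> psize (\<Lambda> i) = psize \<alpha> + i" "psize \<beta> = psize \<alpha> + l"
    and keys: "Poly_Mapping.keys (schur_comb C) =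
      {\<gamma>. \<exists>i\<le>l. dominated (row_lengths (\<Lambda> i)) UNIV (vec_nth \<gamma>)}"
  define a where "a S = sum (row_lengths \<alpha>) {CARD('m) - card S..<CARD('m)}" for S :: "'m set"
  define b where "b S = sum (row_lengths \<beta>) {..<card S}" for S :: "'m set"
  define Q where "Q = {x :: real^('m::{finite,linorder}). \<forall>S. real (a S) \<le> (\<Sum>i\<in>S. x $ i) \<and> (\<Sum>i\<in>S. x $ i) \<le> real (b S)}"
  have "real_vec \<gamma> \<in> Q" if \<gamma>: "\<gamma> \<in> Poly_Mapping.keys (schur_comb C)" for \<gamma>
  proof -
    obtain i where i: "i \<le> l" and dom: "dominated (row_lengths (\<Lambda> i)) UNIV (vec_nth \<gamma>)"
      using \<gamma> by (auto simp: keys)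
    let ?\<mu> = "row_lengths (\<Lambda> i)"
    have le: "sum (vec_nth \<gamma>) S \<le> sum ?\<mu> {..<card S}" for S
      using dom by (simp add: dominated_def)
    have "a S \<le> sum (vec_nth \<gamma>) S \<and> sum (vec_nth \<gamma>) S \<le> b S" for S
    proof
      have "sum ?\<mu> {..<card S} \<le> b S"
        unfolding b_def by (intro sum_mono greedy_bounds(2)[OF greedy[OF i]])
      then show "sum (vec_nth \<gamma>) S \<le> b S" using le[of S] by simp
      have "a S \<le> sum ?\<mu> {CARD('m) - card S..<CARD('m)}"
        unfolding a_def by (intro sum_mono greedy_bounds(1)[OF greedy[OF i]])
      moreover have "sum ?\<mu> {..<CARD('m) - card S} + sum ?\<mu> {CARD('m) - card S..<CARD('m)}
          = sum (vec_nth \<gamma>) UNIV"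
        using dom by (simp add: sum_row_lengths_cut dominated_def sum_row_lengths_total)
      moreover have "sum (vec_nth \<gamma>) S + sum (vec_nth \<gamma>) (- S) = sum (vec_nth \<gamma>) UNIV"
        by (simp add: sum.union_disjoint[symmetric])
      moreover have "card (- S) = CARD('m) - card S" by (simp add: Compl_eq_Diff_UNIV card_Diff_subset)
      ultimately show "a S \<le> sum (vec_nth \<gamma>) S" using le[of "- S"] by simp
    qed
    then show ?thesis
      by (simp add: Q_def real_vec_def flip: of_nat_sum)
  qed
  then have "Newton (schur_comb C) \<subseteq> Q"
    unfolding Newton_def Q_def using convex_sum_coordinates_box by (intro hull_minimal) auto
  then have xQ: "real (a S) \<le> (\<Sum>i\<in>S. x $ i)" "(\<Sum>i\<in>S. x $ i) \<le> real (b S)" for S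
    using x by (auto simp: Q_def)
  define p where "p i = nat \<lfloor>real t * x $ i\<rfloor>" for i
  have p: "real (p i) = real t * x $ i" for i
  proof -
    have "0 \<le> x $ i" using xQ(1)[of "{i}"] by (simp add: order_trans[OF of_nat_0_le_iff])
    moreover have "real t * x $ i \<in> \<int>" using lattice by (simp add: lattice_points_def)
    ultimately show ?thesis by (simp add: p_def Ints_def)
  qed
  have p_sum: "real (sum p S) = real t * (\<Sum>i\<in>S. x $ i)" for S
    by (simp add: p sum_distrib_left)
  have upper: "sum p S \<le> t * b S" for S
  proof -
    have "real (sum p S) \<le> real (t * b S)"
      unfolding p_sum using xQ(2)[of S] by (simp add: mult_left_mono)
    then show ?thesis by linarith
  qed
  have lower: "t * a S \<le> sum p S" for S
  proof -
    have "real (t * a S) \<le> real (sum p S)"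
      unfolding p_sum using xQ(1)[of S] by (simp add: mult_left_mono)
    then show ?thesis by linarith
  qed
  show thesis
  proof (rule chain_decomposition[OF t greedy size upper[unfolded b_def] lower[unfolded a_def]])
    fix i v assume i: "\<And>j. j < t \<Longrightarrow> i j \<le> l"
      and v: "\<And>j. j < t \<Longrightarrow> dominated (row_lengths (\<Lambda> (i j))) UNIV (v j)"
      and pv: "\<And>k. p k = (\<Sum>j<t. v j k)"
    have "(\<chi> k. v j k) \<in> Poly_Mapping.keys (schur_comb C)" if "j < t" for j
      using i[OF that] v[OF that] unfolding keys by (auto simp: vec_lambda_inverse)
    moreover have "real t *\<^sub>R x = (\<Sum>j<t. real_vec (\<chi> k. v j k))"
      by (simp add: vec_eq_iff real_vec_def p[symmetric] pv)
    ultimately show thesis by (rule that)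
  qed
qed

theorem theorem4p2:
  fixes C :: "nat^('m::{finite,linorder}) \<Rightarrow> complex"
  assumes "finite {\<mu>. C \<mu> \<noteq> 0}"
    and "\<And>\<mu>. C \<mu> \<noteq> 0 \<Longrightarrow> is_partition \<mu>"
    and "good C"
  shows "SNP (schur_comb C) \<and> IDP (Newton (schur_comb C))"
proof
  have part: "\<forall>\<mu>. C \<mu> \<noteq> 0 \<longrightarrow> is_partition \<mu>" using assms(2) by blast
  let ?K = "Poly_Mapping.keys (schur_comb C)"
  have sub: "real_vec \<gamma> \<in> Newton (schur_comb C) \<inter> lattice_points" if "\<gamma> \<in> ?K" for \<gamma>
    using that by (auto simp: Newton_def lattice_points_def real_vec_def intro: hull_inc)
  show "SNP (schur_comb C)"
    unfolding SNP_def
  proof (intro equalityI subsetI)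
    fix x assume "x \<in> Newton (schur_comb C) \<inter> lattice_points"
    then obtain v where "v (0::nat) \<in> ?K" "x = real_vec (v 0)"
      using newton_decomposition[OF assms(1) part assms(3), of 1 x] by auto
    then show "x \<in> real_vec ` ?K" by simp
  qed (use sub in auto)
  show "IDP (Newton (schur_comb C))"
    unfolding IDP_def lattice_polytope_def
  proof (intro conjI allI impI ballI)
    show "polytope (Newton (schur_comb C))"
      unfolding polytope_def Newton_def by (intro exI[of _ "real_vec ` ?K"]) simp
    fix x assume "x extreme_point_of Newton (schur_comb C)"
    then show "x \<in> lattice_points"
      using extreme_point_of_convex_hull[of x "real_vec ` ?K"] sub by (auto simp: Newton_def)
  next
    fix t :: nat and p assume t: "0 < t"
      and "p \<in> (\<lambda>v. real t *\<^sub>R v) ` Newton (schur_comb C) \<inter> lattice_points"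
    then obtain x where x: "x \<in> Newton (schur_comb C)" "real t *\<^sub>R x \<in> lattice_points"
      "p = real t *\<^sub>R x" by auto
    obtain v where "\<And>j. j < t \<Longrightarrow> v j \<in> ?K" "real t *\<^sub>R x = (\<Sum>j<t. real_vec (v j))"
      using newton_decomposition[OF assms(1) part assms(3) t x(1,2)] by blast
    then show "\<exists>v. (\<forall>i<t. v i \<in> Newton (schur_comb C) \<inter> lattice_points) \<and> p = (\<Sum>i<t. v i)"
      using sub x(3) by (intro exI[of _ "\<lambda>j. real_vec (v j)"]) simp
  qed
qed

end
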